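(* Let $\mathsf{AP}$ be a finite set of atomic propositions containing at least two propositions. Then $\mathsf{LTL}_{\mathsf{F},\mathsf{X},\wedge,\vee}[\mathsf{AP}]$ does not admit finite characterizations over $\mathcal{W}^{\mathsf{all}}$.
   Context: Words: for a countable ordinal $\alpha$, an $\alpha$-word is a function $w:\alpha\to\mathcal{P}(\mathsf{AP})$; $|w|=\alpha$; for $\beta<|w|$, $w[\beta..]$ is the suffix $w'$ with $w'[\gamma]=w[\beta+\gamma]$. $\mathcal{W}^{\mathsf{all}}$ is the set of all words of countable ordinal length. Semantics: $w\models p$ iff $p\in w[0]$; $\land,\lor$ as usual; $w\models\mathsf{X}\varphi$ iff $|w|>1$ and $w[1..]\models\varphi$; $w\models\mathsf{F}\varphi$ iff there is $\alpha<|w|$ with $w[\alpha..]\models\varphi$. $\mathsf{LTL}_{\mathsf{F},\mathsf{X},\wedge,\vee}[\mathsf{AP}]$ is the set of formulas built from atomic propositions in $\mathsf{AP}$ using only $\mathsf{F},\mathsf{X},\wedge,\vee$. $[\![\varphi]\!]$ is the set of words in $\mathcal{W}^{\mathsf{all}}$ satisfying $\varphi$. A labeled example is $(w,\ell)$, $\ell\in\{+,-\}$; $\varphi$ fits it if ($w\models\varphi$ and $\ell=+$) or ($w\not\models\varphi$ and $\ell=-$). A fragment $\mathcal{L}$ admits finite characterizations over $\mathcal{W}^{\mathsf{all}}$ if for every $\varphi\in\mathcal{L}$ there is a finite set $E$ of labeled examples such that $\varphi$ fits $E$ and every $\psi\in\mathcal{L}$ fitting $E$ satisfies $[\![\psi]\!]=[\![\varphi]\!]$.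 *)

theory Defs
  imports Main "HOL-Library.FuncSet"
begin

section \<open>Countable ordinals\<close>

text \<open>
  A countable ordinal is the order type of a well-order whose field is a set of natural numbers
  (a reflexive relation \<open>r\<close> with \<open>Well_order r\<close>).  The relation \<^const>\<open>ordIso\<close> relates only
  well-orders, so it is a partial equivalence relation on all relations on \<^typ>\<open>nat\<close>.
\<close>

quotient_type cord = "nat rel" / partial: "\<lambda>r s. (r, s) \<in> ordIso"
proof (rule part_equivpI)
  have "Well_order ({} :: nat rel)" by simp
  then show "\<exists>r :: nat rel. (r, r) \<in> ordIso" using ordIso_reflexive by blast
  show "symp (\<lambda>r s :: nat rel. (r, s) \<in> ordIso)" by (auto intro: sympI ordIso_symmetric)
  show "transp (\<lambda>r s :: nat rel. (r, s) \<in> ordIso)" by (auto intro: transpI ordIso_transitive)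
qed

lemma ordIso_refl_iff: "(r, r) \<in> ordIso \<longleftrightarrow> Well_order r"
  using ordIso_reflexive by (auto simp: ordIso_def)

text \<open>The ordered sum: a copy of \<open>r\<close> on the even numbers, followed by a copy of \<open>s\<close> on the odd
  numbers.\<close>

definition osum :: "nat rel \<Rightarrow> nat rel \<Rightarrow> nat rel" where
  "osum r s = {(2 * a, 2 * b) | a b. (a, b) \<in> r} \<union> {(Suc (2 * a), Suc (2 * b)) | a b. (a, b) \<in> s}
     \<union> {(2 * a, Suc (2 * b)) | a b. a \<in> Field r \<and> b \<in> Field s}"

lemma even_neq_odd [simp]: "2 * a \<noteq> Suc (2 * b)" "Suc (2 * b) \<noteq> 2 * a"
  by presburger+

lemma osum_iff [simp]:
  "(2 * a, 2 * b) \<in> osum r s \<longleftrightarrow> (a, b) \<in> r"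
  "(Suc (2 * a), Suc (2 * b)) \<in> osum r s \<longleftrightarrow> (a, b) \<in> s"
  "(2 * a, Suc (2 * b)) \<in> osum r s \<longleftrightarrow> a \<in> Field r \<and> b \<in> Field s"
  "(Suc (2 * a), 2 * b) \<notin> osum r s"
  unfolding osum_def by auto

lemma nat_parity_cases: obtains a where "n = 2 * a" | a where "n = Suc (2 * a)"
  by (metis evenE oddE Suc_eq_plus1)

lemma Field_osum_iff [simp]:
  "2 * a \<in> Field (osum r s) \<longleftrightarrow> a \<in> Field r"
  "Suc (2 * a) \<in> Field (osum r s) \<longleftrightarrow> a \<in> Field s"
proof -
  have "2 * a \<in> Field (osum r s)" if "a \<in> Field r"
    using that unfolding Field_def by (auto simp: Domain_iff Range_iff) (metis osum_iff(1))+
  moreover have "Suc (2 * a) \<in> Field (osum r s)" if "a \<in> Field s"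
    using that unfolding Field_def by (auto simp: Domain_iff Range_iff) (metis osum_iff(2))+
  moreover have "a \<in> Field r" if "2 * a \<in> Field (osum r s)"
    using that by (auto simp: osum_def Field_def)
  moreover have "a \<in> Field s" if "Suc (2 * a) \<in> Field (osum r s)"
    using that by (auto simp: osum_def Field_def)
  ultimately show "2 * a \<in> Field (osum r s) \<longleftrightarrow> a \<in> Field r"
    "Suc (2 * a) \<in> Field (osum r s) \<longleftrightarrow> a \<in> Field s" by blast+
qed

lemma Field_osum: "Field (osum r s) = (\<lambda>n. 2 * n) ` Field r \<union> (\<lambda>n. Suc (2 * n)) ` Field s"
proof (rule set_eqI)
  fix x
  show "x \<in> Field (osum r s) \<longleftrightarrow> x \<in> (\<lambda>n. 2 * n) ` Field r \<union> (\<lambda>n. Suc (2 * n)) ` Field s"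
    by (cases x rule: nat_parity_cases) (simp_all add: image_iff)
qed

lemma Well_order_least:
  assumes "Well_order r" "B \<subseteq> Field r" "B \<noteq> {}"
  obtains x where "x \<in> B" "\<forall>y\<in>B. (x, y) \<in> r"
proof -
  have "Linear_order r" using assms(1) by (simp add: well_order_on_def)
  from Linear_order_Well_order_iff[OF this] have "\<exists>x\<in>B. \<forall>y\<in>B. (x, y) \<in> r"
    using assms by simp
  with that show thesis by blast
qed

lemma Well_order_osum:
  assumes r: "Well_order r" and s: "Well_order s"
  shows "Well_order (osum r s)"
proof -
  have R: "Refl r" "trans r" "antisym r" "Total r" and S: "Refl s" "trans s" "antisym s" "Total s"
    using r s by (auto simp: order_on_defs)
  have rm: "(a, b) \<in> r \<Longrightarrow> a \<in> Field r \<and> b \<in> Field r" for a b by (auto simp: Field_def)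
  have sm: "(a, b) \<in> s \<Longrightarrow> a \<in> Field s \<and> b \<in> Field s" for a b by (auto simp: Field_def)
  have 0: "osum r s \<subseteq> Field (osum r s) \<times> Field (osum r s)" by (auto simp: Field_def)
  have 1: "Refl (osum r s)"
    using R(1) S(1) by (auto simp: refl_on_def Field_osum)
  have 2: "trans (osum r s)"
  proof (rule transI)
    fix x y z assume "(x, y) \<in> osum r s" "(y, z) \<in> osum r s"
    then show "(x, z) \<in> osum r s"
      by (cases x rule: nat_parity_cases; cases y rule: nat_parity_cases;
          cases z rule: nat_parity_cases)
         (use R(2) S(2) rm sm in \<open>auto dest: transD\<close>)
  qed
  have 3: "antisym (osum r s)"
  proof (rule antisymI)
    fix x y assume "(x, y) \<in> osum r s" "(y, x) \<in> osum r s"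
    then show "x = y"
      by (cases x rule: nat_parity_cases; cases y rule: nat_parity_cases)
         (use R(3) S(3) in \<open>auto dest: antisymD\<close>)
  qed
  have 4: "Total (osum r s)"
  proof (rule total_onI)
    fix x y assume "x \<in> Field (osum r s)" "y \<in> Field (osum r s)" "x \<noteq> y"
    then show "(x, y) \<in> osum r s \<or> (y, x) \<in> osum r s"
      by (cases x rule: nat_parity_cases; cases y rule: nat_parity_cases)
         (use R(4) S(4) in \<open>simp_all add: total_on_def\<close>)
  qed
  have lin: "Linear_order (osum r s)" using 0 1 2 3 4 by (auto simp: order_on_defs)
  have "\<exists>x\<in>A. \<forall>y\<in>A. (x, y) \<in> osum r s" if A: "A \<subseteq> Field (osum r s)" "A \<noteq> {}" for A
  proof (cases "\<exists>a. 2 * a \<in> A")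
    case True
    let ?B = "{a. 2 * a \<in> A}"
    have "?B \<subseteq> Field r" "?B \<noteq> {}" using A True by auto
    then obtain x where x: "x \<in> ?B" "\<forall>y\<in>?B. (x, y) \<in> r"
      using Well_order_least[OF r] by blast
    have "(2 * x, y) \<in> osum r s" if "y \<in> A" for y
    proof (cases y rule: nat_parity_cases)
      case (1 a)
      then show ?thesis using that x by simp
    next
      case (2 a)
      have "x \<in> Field r" "a \<in> Field s"
        using A(1) x(1) that unfolding 2 by (metis Field_osum_iff mem_Collect_eq subsetD)+
      then show ?thesis using 2 by simp
    qed
    with x show ?thesis by blast
  next
    case False
    let ?B = "{a. Suc (2 * a) \<in> A}"
    have odd: "\<exists>a. y = Suc (2 * a)" if "y \<in> A" for y
      using that False by (cases y rule: nat_parity_cases) auto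
    have "?B \<subseteq> Field s" "?B \<noteq> {}" using A odd by auto
    then obtain x where x: "x \<in> ?B" "\<forall>y\<in>?B. (x, y) \<in> s"
      using Well_order_least[OF s] by blast
    have "(Suc (2 * x), y) \<in> osum r s" if "y \<in> A" for y
      using odd[OF that] that x by auto
    with x show ?thesis by blast
  qed
  then show ?thesis using Linear_order_Well_order_iff[OF lin] by blast
qed

lemma ordIso_iff_bij:
  "(r, s) \<in> ordIso \<longleftrightarrow> Well_order r \<and> Well_order s \<and> (\<exists>f. bij_betw f (Field r) (Field s) \<and>
     (\<forall>a\<in>Field r. \<forall>b\<in>Field r. (a, b) \<in> r \<longleftrightarrow> (f a, f b) \<in> s))"
  unfolding ordIso_def by (auto simp: iso_iff2)

lemma ordIsoI:
  assumes "Well_order r" "Well_order s" "inj_on f (Field r)" "f ` Field r = Field s"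
    "\<forall>a\<in>Field r. \<forall>b\<in>Field r. (a, b) \<in> r \<longleftrightarrow> (f a, f b) \<in> s"
  shows "(r, s) \<in> ordIso"
  unfolding ordIso_iff_bij bij_betw_def using assms by (intro conjI exI[of _ f])

lemma osum_cong:
  assumes "(r, r') \<in> ordIso" "(s, s') \<in> ordIso"
  shows "(osum r s, osum r' s') \<in> ordIso"
proof -
  obtain f where f: "bij_betw f (Field r) (Field r')"
    "\<forall>a\<in>Field r. \<forall>b\<in>Field r. (a, b) \<in> r \<longleftrightarrow> (f a, f b) \<in> r'"
    using assms(1) unfolding ordIso_iff_bij by blast
  obtain g where g: "bij_betw g (Field s) (Field s')"
    "\<forall>a\<in>Field s. \<forall>b\<in>Field s. (a, b) \<in> s \<longleftrightarrow> (g a, g b) \<in> s'"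
    using assms(2) unfolding ordIso_iff_bij by blast
  define h where "h n = (if even n then 2 * f (n div 2) else Suc (2 * g (n div 2)))" for n
  have h [simp]: "h (2 * a) = 2 * f a" "h (Suc (2 * a)) = Suc (2 * g a)" for a
    by (auto simp: h_def)
  have mem: "a \<in> Field r \<Longrightarrow> f a \<in> Field r'" "b \<in> Field s \<Longrightarrow> g b \<in> Field s'" for a b
    using f(1) g(1) bij_betwE by fast+
  have inj: "inj_on f (Field r)" "inj_on g (Field s)"
    and im: "Field r' = f ` Field r" "Field s' = g ` Field s"
    using f(1) g(1) by (simp_all add: bij_betw_def)
  have "inj_on h (Field (osum r s))"
  proof (rule inj_onI)
    fix x y assume "x \<in> Field (osum r s)" "y \<in> Field (osum r s)" "h x = h y"
    then show "x = y"
      by (cases x rule: nat_parity_cases; cases y rule: nat_parity_cases)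
         (simp_all add: inj_on_eq_iff[OF inj(1)] inj_on_eq_iff[OF inj(2)])
  qed
  moreover have "h ` Field (osum r s) = Field (osum r' s')"
    unfolding Field_osum im by (simp add: image_Un image_image)
  moreover have "\<forall>a\<in>Field (osum r s). \<forall>b\<in>Field (osum r s).
      (a, b) \<in> osum r s \<longleftrightarrow> (h a, h b) \<in> osum r' s'"
  proof (intro ballI)
    fix x y assume "x \<in> Field (osum r s)" "y \<in> Field (osum r s)"
    then show "(x, y) \<in> osum r s \<longleftrightarrow> (h x, h y) \<in> osum r' s'"
      by (cases x rule: nat_parity_cases; cases y rule: nat_parity_cases) (simp_all add: f(2) g(2) mem)
  qed
  moreover have "Well_order (osum r s)" "Well_order (osum r' s')"
    using assms by (auto simp: ordIso_def intro!: Well_order_osum)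
  ultimately show ?thesis by (intro ordIsoI[where f = h])
qed

lemma osum_assoc:
  assumes "Well_order r" "Well_order s" "Well_order t"
  shows "(osum (osum r s) t, osum r (osum s t)) \<in> ordIso"
proof -
  define e d where "e n = 2 * n" and "d n = Suc (2 * n)" for n :: nat
  have ed [simp]: "e a = e b \<longleftrightarrow> a = b" "d a = d b \<longleftrightarrow> a = b" "e a \<noteq> d b" "d b \<noteq> e a" for a b
    unfolding e_def d_def by auto
  have osum_ed [simp]: "(e a, e b) \<in> osum u v \<longleftrightarrow> (a, b) \<in> u" "(d a, d b) \<in> osum u v \<longleftrightarrow> (a, b) \<in> v"
    "(e a, d b) \<in> osum u v \<longleftrightarrow> a \<in> Field u \<and> b \<in> Field v" "(d a, e b) \<notin> osum u v" for a b u v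
    unfolding e_def d_def by (rule osum_iff)+
  have F: "Field (osum u v) = e ` Field u \<union> d ` Field v" for u v
    unfolding e_def d_def by (rule Field_osum)
  define h where "h n = (if odd n then d (d (n div 2))
    else if odd (n div 2) then d (e (n div 2 div 2)) else e (n div 2 div 2))" for n
  have h [simp]: "h (e (e a)) = e a" "h (e (d a)) = d (e a)" "h (d a) = d (d a)" for a
    unfolding h_def by (simp_all add: e_def d_def)
  have "inj_on h (Field (osum (osum r s) t))"
    unfolding F inj_on_def by auto
  moreover have "h ` Field (osum (osum r s) t) = Field (osum r (osum s t))"
    unfolding F by (simp add: image_Un image_image Un_assoc)
  moreover have "\<forall>a\<in>Field (osum (osum r s) t). \<forall>b\<in>Field (osum (osum r s) t).
      (a, b) \<in> osum (osum r s) t \<longleftrightarrow> (h a, h b) \<in> osum r (osum s t)"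
    unfolding F by (auto simp: F)
  ultimately show ?thesis
    using assms by (intro ordIsoI[where f = h] Well_order_osum)
qed

lemma osum_empty_left:
  assumes "Well_order r" shows "(osum {} r, r) \<in> ordIso"
proof -
  have "bij_betw (\<lambda>n. n div 2) (Field (osum {} r)) (Field r)"
    by (auto simp: bij_betw_def inj_on_def Field_osum image_image)
  moreover have "\<forall>a\<in>Field (osum {} r). \<forall>b\<in>Field (osum {} r).
      (a, b) \<in> osum {} r \<longleftrightarrow> (a div 2, b div 2) \<in> r"
    by (auto simp: Field_osum)
  moreover have "Well_order (osum {} r)" using assms by (intro Well_order_osum) auto
  ultimately show ?thesis
    using assms by (intro ordIsoI[where f = "\<lambda>n. n div 2"]) (auto simp: bij_betw_def)
qed

lemma osum_empty_right:
  assumes "Well_order r" shows "(osum r {}, r) \<in> ordIso"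
proof -
  have "bij_betw (\<lambda>n. n div 2) (Field (osum r {})) (Field r)"
    by (auto simp: bij_betw_def inj_on_def Field_osum image_image)
  moreover have "\<forall>a\<in>Field (osum r {}). \<forall>b\<in>Field (osum r {}).
      (a, b) \<in> osum r {} \<longleftrightarrow> (a div 2, b div 2) \<in> r"
    by (auto simp: Field_osum)
  moreover have "Well_order (osum r {})" using assms by (intro Well_order_osum) auto
  ultimately show ?thesis
    using assms by (intro ordIsoI[where f = "\<lambda>n. n div 2"]) (auto simp: bij_betw_def)
qed

lemma ordLess_osum:
  assumes "Well_order r" "Well_order s" "s \<noteq> {}"
  shows "(r, osum r s) \<in> ordLess"
proof -
  have wo: "Well_order (osum r s)" using assms(1,2) by (rule Well_order_osum)
  have under: "under (osum r s) (2 * a) = (\<lambda>n. 2 * n) ` under r a" for a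
  proof -
    have "x \<in> under (osum r s) (2 * a) \<longleftrightarrow> x \<in> (\<lambda>n. 2 * n) ` under r a" for x
      by (cases x rule: nat_parity_cases) (simp_all add: under_def image_iff)
    then show ?thesis by blast
  qed
  have "embed r (osum r s) (\<lambda>n. 2 * n)"
    unfolding embed_def by (auto simp: bij_betw_def inj_on_def under)
  moreover have "\<not> bij_betw (\<lambda>n. 2 * n) (Field r) (Field (osum r s))"
  proof -
    obtain a where "a \<in> Field s" using assms(3) by (auto simp: Field_def)
    then have "Suc (2 * a) \<in> Field (osum r s)" "Suc (2 * a) \<notin> (\<lambda>n. 2 * n) ` Field r" by auto
    then show ?thesis by (auto simp: bij_betw_def)
  qed
  ultimately show ?thesis using assms(1) wo by (auto simp: ordLess_def embedS_def)
qed

lemma ordLeq_imp_osum: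
  fixes r s :: "nat rel"
  assumes "(r, s) \<in> ordLeq"
  shows "\<exists>t. Well_order t \<and> (osum r t, s) \<in> ordIso"
proof -
  obtain f where f: "embed r s f" and r: "Well_order r" and s: "Well_order s"
    using assms by (auto simp: ordLeq_def)
  have of: "wo_rel.ofilter s (f ` Field r)" using embed_Field_ofilter[OF r s f] .
  have sub: "f ` Field r \<subseteq> Field s" using of s by (simp add: wo_rel.ofilter_def wo_rel_def)
  have inj: "inj_on f (Field r)" using embed_inj_on[OF r f] .
  have iff: "(a, b) \<in> r \<longleftrightarrow> (f a, f b) \<in> s" if "a \<in> Field r" "b \<in> Field r" for a b
  proof -
    have "bij_betw f (under r b) (under s (f b))" using f that by (auto simp: embed_def)
    then have *: "f ` under r b = under s (f b)" by (auto simp: bij_betw_def)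
    show ?thesis
    proof
      assume "(a, b) \<in> r"
      then show "(f a, f b) \<in> s" using * by (auto simp: under_def)
    next
      assume "(f a, f b) \<in> s"
      then obtain c where c: "(c, b) \<in> r" "f c = f a" using * by (force simp: under_def)
      then have "c = a" using inj that by (auto simp: inj_on_def Field_def)
      then show "(a, b) \<in> r" using c by simp
    qed
  qed
  define B where "B = Field s - f ` Field r"
  define t where "t = Restr s B"
  have t: "Well_order t" using s Well_order_Restr by (auto simp: t_def)
  have refl: "(x, x) \<in> s" if "x \<in> Field s" for x
    using s that by (auto simp: order_on_defs refl_on_def)
  have Ft: "Field t = B" using refl by (auto simp: t_def B_def Field_def)
  have below: "(f a, b) \<in> s \<and> (b, f a) \<notin> s" if "a \<in> Field r" "b \<in> B" for a b
  proof -
    have fa: "f a \<in> Field s" and b: "b \<in> Field s" and ne: "f a \<noteq> b"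
      using sub that by (auto simp: B_def)
    have "(b, f a) \<notin> s"
      using of s that by (auto simp: wo_rel.ofilter_def wo_rel_def B_def under_def)
    moreover have "(f a, b) \<in> s \<or> (b, f a) \<in> s"
      using s fa b ne by (auto simp: order_on_defs total_on_def)
    ultimately show ?thesis by blast
  qed
  define h where "h n = (if even n then f (n div 2) else n div 2)" for n
  have h [simp]: "h (2 * a) = f a" "h (Suc (2 * a)) = a" for a by (auto simp: h_def)
  have "inj_on h (Field (osum r t))"
  proof (rule inj_onI)
    fix x y assume "x \<in> Field (osum r t)" "y \<in> Field (osum r t)" "h x = h y"
    then show "x = y"
      by (cases x rule: nat_parity_cases; cases y rule: nat_parity_cases)
         (auto simp: inj_on_eq_iff[OF inj] Ft B_def)
  qed
  moreover have "h ` Field (osum r t) = Field s"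
    using sub by (auto simp: Field_osum Ft B_def image_Un image_image)
  moreover have "\<forall>a\<in>Field (osum r t). \<forall>b\<in>Field (osum r t). (a, b) \<in> osum r t \<longleftrightarrow> (h a, h b) \<in> s"
    using iff below by (auto simp: Field_osum Ft) (auto simp: t_def)
  moreover have "Well_order (osum r t)" using r t by (rule Well_order_osum)
  ultimately have "(osum r t, s) \<in> ordIso" using s by (intro ordIsoI[where f = h])
  with t show ?thesis by blast
qed

instantiation cord :: "{wellorder, monoid_add, zero_neq_one}"
begin

lift_definition zero_cord :: cord is "{}"
  by (simp add: ordIso_refl_iff)

lift_definition one_cord :: cord is "{(0, 0)}"
  unfolding ordIso_refl_iff
  by (auto simp: order_on_defs refl_on_def trans_def antisym_def total_on_def Field_def)

lift_definition plus_cord :: "cord \<Rightarrow> cord \<Rightarrow> cord" is osum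
  by (rule osum_cong)

lift_definition less_eq_cord :: "cord \<Rightarrow> cord \<Rightarrow> bool" is "\<lambda>r s. (r, s) \<in> ordLeq"
  by (meson ordIso_ordLeq_trans ordIso_symmetric ordLeq_ordIso_trans)

lift_definition less_cord :: "cord \<Rightarrow> cord \<Rightarrow> bool" is "\<lambda>r s. (r, s) \<in> ordLess"
  by (meson ordIso_ordLess_trans ordIso_symmetric ordLess_ordIso_trans)

instance
proof
  fix a b c :: cord
  show "a < b \<longleftrightarrow> a \<le> b \<and> \<not> b \<le> a"
    by transfer (meson not_ordLeq_iff_ordLess ordIso_refl_iff ordLess_imp_ordLeq)
  show "a \<le> a" by transfer (simp add: ordIso_refl_iff ordLeq_reflexive)
  show "a \<le> b \<Longrightarrow> b \<le> c \<Longrightarrow> a \<le> c" by transfer (rule ordLeq_transitive)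
  show "a \<le> b \<Longrightarrow> b \<le> a \<Longrightarrow> a = b" by transfer (simp add: ordIso_iff_ordLeq)
  show "a \<le> b \<or> b \<le> a" by transfer (simp add: ordIso_refl_iff ordLeq_total)
  show "a + b + c = a + (b + c)" by transfer (simp add: ordIso_refl_iff osum_assoc)
  show "0 + a = a" by transfer (simp add: ordIso_refl_iff osum_empty_left)
  show "a + 0 = a" by transfer (simp add: ordIso_refl_iff osum_empty_right)
  show "(0 :: cord) \<noteq> 1"
    by transfer (auto simp: ordIso_iff_bij bij_betw_def)
next
  fix P :: "cord \<Rightarrow> bool" and a :: cord
  assume step: "\<And>x. (\<And>y. y < x \<Longrightarrow> P y) \<Longrightarrow> P x"
  have "wf {(x :: cord, y). x < y}"
  proof (rule wf_subset)
    show "wf (inv_image ordLess rep_cord)" by (rule wf_inv_image[OF wf_ordLess])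
    show "{(x :: cord, y). x < y} \<subseteq> inv_image ordLess rep_cord"
      by (auto simp: less_cord.rep_eq)
  qed
  then show "P a" by (induction a rule: wf_induct_rule) (use step in blast)
qed

end

lemma cord_less_add:
  fixes a b :: cord assumes "b \<noteq> 0" shows "a < a + b"
  using assms by transfer (metis ordIso_refl_iff ordLess_osum)

lemma cord_le_iff_add:
  fixes a b :: cord shows "a \<le> b \<longleftrightarrow> (\<exists>c. b = a + c)"
proof
  show "a \<le> b \<Longrightarrow> \<exists>c. b = a + c"
  proof (transfer, goal_cases)
    case (1 r s)
    then obtain t where t: "Well_order t" "(osum r t, s) \<in> ordIso"
      using ordLeq_imp_osum by blast
    show ?case
      by (rule bexI[of _ t]) (use t in \<open>simp_all add: ordIso_symmetric ordIso_refl_iff Respects_def\<close>)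
  qed
  show "\<exists>c. b = a + c \<Longrightarrow> a \<le> b"
    by (metis add.right_neutral cord_less_add order.order_iff_strict)
qed

lemma cord_zero_le [simp]: "0 \<le> (a :: cord)"
  using cord_le_iff_add by fastforce

lemma cord_add_strict_left_mono:
  fixes a b c :: cord assumes "b < c" shows "a + b < a + c"
proof -
  obtain d where d: "c = b + d" using assms cord_le_iff_add[of b c] by auto
  with assms have "d \<noteq> 0" by auto
  then have "a + b < (a + b) + d" by (rule cord_less_add)
  then show ?thesis by (simp add: d add.assoc)
qed

lemma cord_add_less_cancel_left [simp]:
  fixes a b c :: cord shows "a + b < a + c \<longleftrightarrow> b < c"
  by (metis cord_add_strict_left_mono less_asym linorder_neqE)

lemma cord_add_left_cancel [simp]:
  fixes a b c :: cord shows "a + b = a + c \<longleftrightarrow> b = c"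
  by (metis cord_add_strict_left_mono less_irrefl linorder_neqE)

lemma cord_less_one_iff [simp]: "(a :: cord) < 1 \<longleftrightarrow> a = 0"
proof
  assume "a < 1"
  then show "a = 0"
  proof (transfer, goal_cases)
    case (1 r)
    then obtain f where f: "embed r {(0 :: nat, 0 :: nat)} f"
      and nb: "\<not> bij_betw f (Field r) {0}" and r: "Well_order r"
      by (auto simp: ordLess_def embedS_def Field_def)
    have wo: "Well_order {(0 :: nat, 0 :: nat)}" using 1 by (auto simp: ordLess_def)
    have "f ` Field r \<subseteq> {0}" using embed_Field[OF f] by (auto simp: Field_def)
    moreover have "inj_on f (Field r)" using embed_inj_on[OF r f] .
    ultimately have "Field r = {}" using nb unfolding bij_betw_def by (metis image_is_empty subset_singletonD)
    then have "r = {}" by (auto simp: Field_def)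
    then show ?case using r by (simp add: ordIso_refl_iff)
  qed
next
  show "a = 0 \<Longrightarrow> a < 1" using zero_neq_one[where 'a = cord] cord_zero_le[of 1] by (auto simp: order_less_le)
qed

text \<open>Left subtraction: for \<open>b \<le> a\<close>, the unique \<open>c\<close> with \<open>b + c = a\<close>.\<close>

definition cord_diff :: "cord \<Rightarrow> cord \<Rightarrow> cord" where
  "cord_diff a b = (THE c. b + c = a)"

lemma cord_diff_add [simp]: "cord_diff (b + c) b = c"
  unfolding cord_diff_def by auto

lemma cord_add_diff: "b \<le> a \<Longrightarrow> b + cord_diff a b = a"
  by (auto simp: cord_le_iff_add)


section \<open>Words of countable ordinal length\<close>

text \<open>
  A word is a pair of its length \<open>\<alpha>\<close> and its letter function, where \<open>\<alpha>\<close> is identified with the set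
  \<open>{..<\<alpha>}\<close> of smaller ordinals.  The letter function is extensional (\<^const>\<open>undefined\<close> outside
  \<open>{..<\<alpha>}\<close>), so that equality of pairs is equality of words.  The empty word is included.
\<close>

type_synonym 'a word = "cord \<times> (cord \<Rightarrow> 'a set)"

definition all_words :: "'a set \<Rightarrow> 'a word set" where
  "all_words AP = (SIGMA \<alpha>:UNIV. {..<\<alpha>} \<rightarrow>\<^sub>E Pow AP)"

abbreviation len :: "'a word \<Rightarrow> cord" where
  "len w \<equiv> fst w"

abbreviation letter :: "'a word \<Rightarrow> cord \<Rightarrow> 'a set" where
  "letter w \<equiv> snd w"

definition suffix :: "'a word \<Rightarrow> cord \<Rightarrow> 'a word" where
  "suffix w \<beta> =
     (cord_diff (len w) \<beta>, \<lambda>\<gamma>\<in>{..<cord_diff (len w) \<beta>}. letter w (\<beta> + \<gamma>))"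

lemma suffix_in_all_words:
  assumes "w \<in> all_words AP" "\<beta> \<le> len w"
  shows "suffix w \<beta> \<in> all_words AP"
proof -
  obtain c where c: "len w = \<beta> + c" using assms(2) cord_le_iff_add by blast
  have "letter w \<gamma> \<subseteq> AP" if "\<gamma> < len w" for \<gamma>
    using assms(1) that by (cases w) (simp add: all_words_def PiE_iff)
  then have "letter w (\<beta> + \<gamma>) \<subseteq> AP" if "\<gamma> < c" for \<gamma>
    using that by (simp add: c)
  then show ?thesis by (auto simp: suffix_def all_words_def c)
qed


section \<open>Formulas, semantics and finite characterizations\<close>

datatype (atoms: 'a) ltl =
    Prop 'a
  | Next "'a ltl"
  | Finally "'a ltl"
  | And "'a ltl" "'a ltl"
  | Or "'a ltl" "'a ltl"

definition LTL_FX :: "'a set \<Rightarrow> 'a ltl set" where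
  "LTL_FX AP = {\<phi>. atoms \<phi> \<subseteq> AP}"

text \<open>The guard in the first equation makes atoms false at the empty word, which has no letter.\<close>

primrec sat :: "'a word \<Rightarrow> 'a ltl \<Rightarrow> bool" (infix "\<Turnstile>" 50) where
  "w \<Turnstile> Prop p \<longleftrightarrow> 0 < len w \<and> p \<in> letter w 0"
| "w \<Turnstile> Next \<phi> \<longleftrightarrow> 1 < len w \<and> suffix w 1 \<Turnstile> \<phi>"
| "w \<Turnstile> Finally \<phi> \<longleftrightarrow> (\<exists>\<alpha><len w. suffix w \<alpha> \<Turnstile> \<phi>)"
| "w \<Turnstile> And \<phi> \<psi> \<longleftrightarrow> w \<Turnstile> \<phi> \<and> w \<Turnstile> \<psi>"
| "w \<Turnstile> Or \<phi> \<psi> \<longleftrightarrow> w \<Turnstile> \<phi> \<or> w \<Turnstile> \<psi>"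

definition sem :: "'a word set \<Rightarrow> 'a ltl \<Rightarrow> 'a word set" where
  "sem W \<phi> = {w \<in> W. w \<Turnstile> \<phi>}"

datatype label = Pos | Neg

type_synonym 'a example = "'a word \<times> label"

definition fits :: "'a ltl \<Rightarrow> 'a example \<Rightarrow> bool" where
  "fits \<phi> = (\<lambda>(w, l). (w \<Turnstile> \<phi> \<and> l = Pos) \<or> (\<not> w \<Turnstile> \<phi> \<and> l = Neg))"

definition admits_finite_characterizations :: "'a ltl set \<Rightarrow> 'a word set \<Rightarrow> bool" where
  "admits_finite_characterizations L W \<longleftrightarrow>
     (\<forall>\<phi>\<in>L. \<exists>E \<subseteq> W \<times> UNIV. finite E \<and> (\<forall>e\<in>E. fits \<phi> e) \<and>
        (\<forall>\<psi>\<in>L. (\<forall>e\<in>E. fits \<psi> e) \<longrightarrow> sem W \<psi> = sem W \<phi>))"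

end

theory Submission
  imports Defs
begin

text \<open>
  The formula \<open>F p\<close> has no finite characterization.  Let \<open>\<psi>\<^sub>n\<close> say that \<open>p\<close>
  holds at some position other than \<open>n\<close>, that is, at one of the positions \<open>0, \<dots>, n - 1\<close> or at
  some position \<open>\<alpha> \<ge> n + 1\<close>.  A word satisfying \<open>F p\<close> violates \<open>\<psi>\<^sub>n\<close> for at most one \<open>n\<close>, so all but
  finitely many \<open>\<psi>\<^sub>n\<close> fit a finite set of examples that \<open>F p\<close> fits; but no \<open>\<psi>\<^sub>n\<close> is equivalent to
  \<open>F p\<close>, because of the word with \<open>p\<close> at position \<open>n\<close> only.
\<close>

lemma len_suffix: "len (suffix w \<beta>) = cord_diff (len w) \<beta>"
  by (simp add: suffix_def)

lemma suffix_suffix: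
  assumes "\<beta> + \<gamma> \<le> len w"
  shows "suffix (suffix w \<beta>) \<gamma> = suffix w (\<beta> + \<gamma>)"
proof -
  obtain c where c: "len w = \<beta> + (\<gamma> + c)"
    using assms by (auto simp: cord_le_iff_add add.assoc)
  have "cord_diff (len w) (\<beta> + \<gamma>) = c"
    unfolding c by (simp flip: add.assoc)
  then show ?thesis
    by (auto simp: suffix_def c add.assoc fun_eq_iff)
qed

lemma cord_one_le_iff: "1 \<le> (\<alpha> :: cord) \<longleftrightarrow> \<alpha> \<noteq> 0"
  by (metis cord_less_one_iff not_le)

text \<open>Stated for atoms only: \<open>w\<close> is an arbitrary pair, and if its letter function
  is not extensional, \<open>suffix w 0\<close> differs from \<open>w\<close> outside the domain.
  The letter at 0 is the same in both.\<close>

lemma sat_suffix_0_Prop: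
  assumes "0 < len w"
  shows "suffix w 0 \<Turnstile> Prop p \<longleftrightarrow> w \<Turnstile> Prop p"
proof -
  have "cord_diff (len w) 0 = len w"
    using cord_diff_add[of 0 "len w"] by simp
  with assms show ?thesis by (simp add: suffix_def)
qed

text \<open>A position is either 0 or of the form \<open>1 + \<beta>\<close>, with \<beta> a
  position of \<open>suffix w 1\<close>. Subtracting 1 on the left covers infinite positions too,
  limits included.\<close>

lemma sat_Finally_Prop_unfold:
  "w \<Turnstile> Finally (Prop p) \<longleftrightarrow> w \<Turnstile> Prop p \<or> w \<Turnstile> Next (Finally (Prop p))" (is "?F \<longleftrightarrow> ?P \<or> ?N")
proof
  assume ?F
  then obtain \<alpha> where \<alpha>: "\<alpha> < len w" "suffix w \<alpha> \<Turnstile> Prop p" by auto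
  show "?P \<or> ?N"
  proof (cases "\<alpha> = 0")
    case True
    then show ?thesis using \<alpha> sat_suffix_0_Prop[of w p] by simp
  next
    case False
    then have "1 \<le> \<alpha>" by (simp add: cord_one_le_iff)
    then obtain \<beta> where \<beta>: "\<alpha> = 1 + \<beta>" by (auto simp: cord_le_iff_add)
    from \<open>1 \<le> \<alpha>\<close> have one: "1 < len w" using \<alpha>(1) by (rule le_less_trans)
    obtain c where c: "len w = 1 + c" using less_imp_le[OF one] by (auto simp: cord_le_iff_add)
    have "\<beta> < len (suffix w 1)"
      using \<alpha>(1) by (simp add: len_suffix c \<beta>)
    moreover have "suffix (suffix w 1) \<beta> \<Turnstile> Prop p"
      using suffix_suffix[of 1 \<beta> w] \<alpha> \<beta> by simp
    ultimately have "suffix w 1 \<Turnstile> Finally (Prop p)"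
      unfolding sat.simps(3) by blast
    then show ?thesis using one by simp
  qed
next
  assume "?P \<or> ?N"
  then show ?F
  proof
    assume ?P
    moreover from this have "0 < len w" by simp
    ultimately show ?F
      unfolding sat.simps(3) by (intro exI[of _ 0]) (simp only: sat_suffix_0_Prop)
  next
    assume ?N
    then obtain \<beta> where one: "1 < len w" and \<beta>: "\<beta> < len (suffix w 1)"
      "suffix (suffix w 1) \<beta> \<Turnstile> Prop p"
      by auto
    obtain c where c: "len w = 1 + c" using less_imp_le[OF one] by (auto simp: cord_le_iff_add)
    have less: "1 + \<beta> < len w" using \<beta>(1) by (simp add: len_suffix c)
    then have "suffix w (1 + \<beta>) \<Turnstile> Prop p"
      using suffix_suffix[of 1 \<beta> w] \<beta>(2) by simp
    with less show ?F unfolding sat.simps(3) by blast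
  qed
qed

text \<open>The formula \<open>\<psi>\<^sub>n\<close>. Each \<open>Suc\<close> tests one position
  and moves on; the base case steps over position n without testing it.\<close>

primrec elsewhere :: "'a \<Rightarrow> nat \<Rightarrow> 'a ltl" where
  "elsewhere p 0 = Next (Finally (Prop p))"
| "elsewhere p (Suc n) = Or (Prop p) (Next (elsewhere p n))"

lemma atoms_elsewhere: "atoms (elsewhere p n) = {p}"
  by (induction n) auto

text \<open>Takes care of the negative examples: a word violating \<open>F p\<close> violates every
  \<open>elsewhere p n\<close>.\<close>

lemma elsewhere_imp_Finally:
  "w \<Turnstile> elsewhere p n \<Longrightarrow> w \<Turnstile> Finally (Prop p)"
proof (induction n arbitrary: w)
  case 0
  then show ?case by (simp add: sat_Finally_Prop_unfold[of w] del: sat.simps)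
next
  case (Suc n)
  from Suc.prems show ?case
    unfolding sat_Finally_Prop_unfold[of w]
    using Suc.IH[of "suffix w 1"] by (auto simp del: sat.simps(1,3))
qed

text \<open>Such a word has p at position m and nowhere else. Removing its first letter lowers both
  indices. If exactly one index is 0, its formula being false forces p at position 0, which makes
  the other formula true.\<close>

lemma not_elsewhere_unique:
  assumes "w \<Turnstile> Finally (Prop p)" "\<not> w \<Turnstile> elsewhere p m" "\<not> w \<Turnstile> elsewhere p n"
  shows "m = n"
  using assms
proof (induction m n arbitrary: w rule: diff_induct)
  case (1 m)
  then show ?case
    unfolding sat_Finally_Prop_unfold[of w] by (cases m) (auto simp del: sat.simps(3))
next
  case (2 n)
  then show ?case
    unfolding sat_Finally_Prop_unfold[of w] by (auto simp del: sat.simps(3))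
next
  case (3 m n)
  from "3.prems" show ?case
    unfolding sat_Finally_Prop_unfold[of w]
    using "3.IH"[of "suffix w 1"] by (auto simp del: sat.simps(1,3))
qed

text \<open>With 1 added on the left, passing to \<open>suffix _ 1\<close> undoes one
  \<open>Suc\<close>.\<close>

primrec cord_of_nat :: "nat \<Rightarrow> cord" where
  "cord_of_nat 0 = 0"
| "cord_of_nat (Suc n) = 1 + cord_of_nat n"

text \<open>The word separating \<open>F p\<close> from \<open>elsewhere p n\<close>. The final 1
  stands on the right, so removing a first letter from the length is mere associativity.\<close>

definition single_word :: "'a \<Rightarrow> nat \<Rightarrow> 'a word" where
  "single_word p n =
     (cord_of_nat n + 1, \<lambda>\<gamma>\<in>{..<cord_of_nat n + 1}. if \<gamma> = cord_of_nat n then {p} else {})"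

lemma single_word_in_all_words: "p \<in> AP \<Longrightarrow> single_word p n \<in> all_words AP"
  by (auto simp: single_word_def all_words_def)

lemma suffix_single_word_Suc: "suffix (single_word p (Suc n)) 1 = single_word p n"
  by (auto simp: suffix_def single_word_def add.assoc fun_eq_iff)

lemma one_less_len_single_word_iff: "1 < len (single_word p n) \<longleftrightarrow> n \<noteq> 0"
proof (cases n)
  case (Suc k)
  have "cord_of_nat k + 1 \<noteq> 0"
    using cord_less_add[of 1 "cord_of_nat k"] cord_zero_le[of "cord_of_nat k"]
    by (metis leD zero_neq_one)
  then show ?thesis
    using cord_less_add[of "cord_of_nat k + 1" 1] by (simp add: Suc single_word_def add.assoc)
qed (simp add: single_word_def)

lemma single_word_sat_Prop_iff: "single_word p n \<Turnstile> Prop p \<longleftrightarrow> n = 0"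
proof (cases n)
  case 0
  then show ?thesis using cord_less_add[of 1 0] by (simp add: single_word_def)
next
  case (Suc k)
  have "1 + cord_of_nat k \<noteq> 0"
    using cord_less_one_iff[of 0] cord_one_le_iff cord_le_iff_add by metis
  then show ?thesis by (simp add: Suc single_word_def)
qed

lemma single_word_sat_Finally: "single_word p n \<Turnstile> Finally (Prop p)"
proof (induction n)
  case 0
  then show ?case
    unfolding sat_Finally_Prop_unfold[of "single_word p 0"] single_word_sat_Prop_iff by simp
next
  case (Suc n)
  then show ?case
    unfolding sat_Finally_Prop_unfold[of "single_word p (Suc n)"]
    by (simp add: suffix_single_word_Suc one_less_len_single_word_iff del: sat.simps(1,3))
qed

text \<open>Removing the first letter lowers both indices; at n = 0 the word has length 1, so the
  outer \<open>Next\<close> fails.\<close>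

lemma single_word_not_sat_elsewhere: "\<not> single_word p n \<Turnstile> elsewhere p n"
  by (induction n)
    (simp_all add: suffix_single_word_Suc one_less_len_single_word_iff single_word_sat_Prop_iff
      del: sat.simps(1,3))

theorem theorem19:
  fixes AP :: "'a set"
  assumes "finite AP" and "2 \<le> card AP"
  shows "\<not> admits_finite_characterizations (LTL_FX AP) (all_words AP)"
proof
  obtain p where p: "p \<in> AP" using assms(2) by fastforce
  let ?\<phi> = "Finally (Prop p)"
  assume "admits_finite_characterizations (LTL_FX AP) (all_words AP)"
  moreover have "?\<phi> \<in> LTL_FX AP" using p by (simp add: LTL_FX_def)
  ultimately obtain E where "finite E" and fits_E: "\<And>e. e \<in> E \<Longrightarrow> fits ?\<phi> e"
    and unique: "\<And>\<psi>. \<psi> \<in> LTL_FX AP \<Longrightarrow> \<forall>e\<in>E. fits \<psi> e \<Longrightarrow> sem (all_words AP) \<psi> = sem (all_words AP) ?\<phi>"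
    unfolding admits_finite_characterizations_def by metis
  let ?bad = "\<lambda>e. {n. \<not> fits (elsewhere p n) e}"
  have "finite (?bad e)" if "e \<in> E" for e
  proof -
    obtain w l where e: "e = (w, l)" by fastforce
    \<comment> \<open>A negative example has no bad index, by \<open>elsewhere_imp_Finally\<close>;
      a positive one has at most one, by \<open>not_elsewhere_unique\<close>.\<close>
    have "m = n" if "m \<in> ?bad e" "n \<in> ?bad e" for m n
      using that fits_E[OF \<open>e \<in> E\<close>] elsewhere_imp_Finally[of w p] not_elsewhere_unique[of w p m n]
      by (auto simp: e fits_def simp del: sat.simps(3))
    then have "?bad e \<subseteq> {n}" if "n \<in> ?bad e" for n using that by blast
    then show ?thesis by (metis finite.emptyI finite_insert finite_subset all_not_in_conv)
  qed
  then have "finite (\<Union>e\<in>E. ?bad e)" using \<open>finite E\<close> by blast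
  then obtain n where "n \<notin> (\<Union>e\<in>E. ?bad e)" using ex_new_if_finite infinite_UNIV_nat by metis
  then have "\<forall>e\<in>E. fits (elsewhere p n) e" by blast
  moreover have "elsewhere p n \<in> LTL_FX AP" using p by (simp add: LTL_FX_def atoms_elsewhere)
  ultimately have "sem (all_words AP) (elsewhere p n) = sem (all_words AP) ?\<phi>" by (intro unique)
  moreover have "single_word p n \<in> sem (all_words AP) ?\<phi>"
    using single_word_in_all_words[OF p] single_word_sat_Finally by (simp add: sem_def del: sat.simps(3))
  ultimately have "single_word p n \<in> sem (all_words AP) (elsewhere p n)" by blast
  then show False by (simp add: sem_def single_word_not_sat_elsewhere)
qed

end
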